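(* Let $G$ be a finite solvable group, let $H$ be a non-normal maximal subgroup of $G$, and let $q \in \pi(F(H/\mathrm{Core}_G H))$. Then $H$ has a Sylow $q$-subgroup $Q$ such that $N_G(H_1) \subseteq H$ for each subgroup $H_1$ of $H$ satisfying $Q \subseteq H_1 \subseteq H$.
   Context: All groups are finite. $F(X)$ denotes the Fitting subgroup of a group $X$; $\pi(Y)$ denotes the set of all prime divisors of $|Y|$ for a finite group $Y$; $\mathrm{Core}_G H = \bigcap_{g\in G} H^g$ is the largest normal subgroup of $G$ contained in $H$; $N_G(X)$ is the normalizer of $X$ in $G$. *)

theory Defs
  imports "HOL-Algebra.Group_Action" "HOL-Algebra.Solvable_Groups" "HOL-Algebra.Sylow"
begin

definition maximal_subgroup :: "'a set \<Rightarrow> ('a, 'b) monoid_scheme \<Rightarrow> bool" where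
  "maximal_subgroup M G \<longleftrightarrow>
     subgroup M G \<and> M \<noteq> carrier G \<and>
     (\<forall>K. subgroup K G \<longrightarrow> M \<subseteq> K \<longrightarrow> K = M \<or> K = carrier G)"

definition normal_core :: "('a, 'b) monoid_scheme \<Rightarrow> 'a set \<Rightarrow> 'a set" where
  "normal_core G H = (\<Inter>g\<in>carrier G. inv\<^bsub>G\<^esub> g <#\<^bsub>G\<^esub> H #>\<^bsub>G\<^esub> g)"

definition commutator_subgroup ::
    "('a, 'b) monoid_scheme \<Rightarrow> 'a set \<Rightarrow> 'a set \<Rightarrow> 'a set" where
  "commutator_subgroup G A B =
     generate G (\<Union>a\<in>A. \<Union>b\<in>B. {a \<otimes>\<^bsub>G\<^esub> b \<otimes>\<^bsub>G\<^esub> inv\<^bsub>G\<^esub> a \<otimes>\<^bsub>G\<^esub> inv\<^bsub>G\<^esub> b})"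

primrec lower_central :: "('a, 'b) monoid_scheme \<Rightarrow> nat \<Rightarrow> 'a set" where
  "lower_central G 0 = carrier G"
| "lower_central G (Suc n) = commutator_subgroup G (lower_central G n) (carrier G)"

definition nilpotent :: "('a, 'b) monoid_scheme \<Rightarrow> bool" where
  "nilpotent G \<longleftrightarrow> (\<exists>n. lower_central G n = {\<one>\<^bsub>G\<^esub>})"

text \<open>The Fitting subgroup is the subgroup generated by all nilpotent normal subgroups; for finite
  groups this is the largest nilpotent normal subgroup, by Fitting's theorem.\<close>
definition fitting_subgroup :: "('a, 'b) monoid_scheme \<Rightarrow> 'a set" where
  "fitting_subgroup G = generate G (\<Union>{N. N \<lhd> G \<and> nilpotent (G\<lparr>carrier := N\<rparr>)})"

text \<open>Intended for finite \<open>G\<close>. If \<open>p\<close> does not divide the order, the trivial subgroup is the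
  Sylow \<open>p\<close>-subgroup.\<close>
definition sylow_subgroup :: "nat \<Rightarrow> 'a set \<Rightarrow> ('a, 'b) monoid_scheme \<Rightarrow> bool" where
  "sylow_subgroup p P G \<longleftrightarrow>
     prime p \<and> subgroup P G \<and> card P = p ^ multiplicity p (order G)"

end

theory Submission
  imports Defs "HOL-Algebra.SndIsomorphismGrp" "HOL-Algebra.Multiplicative_Group"
begin

text \<open>
  Write \<open>K\<close> for the core of \<open>H\<close>. The hypothesis on \<open>q\<close> yields a normal subgroup
  \<open>N\<close> of \<open>H\<close> that properly contains \<open>K\<close> and for which \<open>N / K\<close> is a \<open>q\<close>-group. Since the Fitting
  subgroup of \<open>H / K\<close> has order divisible by \<open>q\<close>, so has some nilpotent normal subgroup \<open>L\<close> of
  \<open>H / K\<close> (\<open>fitting_prime_divisor\<close>). The centre of \<open>L\<close> then contains elements of order \<open>q\<close>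
  (\<open>nilpotent_central_torsion\<close>), and the central elements \<open>z\<close> of \<open>L\<close> with \<open>z\<^sup>q = 1\<close> form a
  nontrivial normal \<open>q\<close>-subgroup of \<open>H / K\<close> (\<open>normal_prime_power_of_nilpotent\<close>); \<open>N\<close> is its
  preimage. An order count gives \<open>N \<subseteq> K Q\<close> for every Sylow \<open>q\<close>-subgroup \<open>Q\<close> of \<open>H\<close>
  (\<open>subset_normal_mult_sylow\<close>), hence \<open>N \<subseteq> K H\<^sub>1\<close> for every subgroup \<open>H\<^sub>1\<close> between \<open>Q\<close> and \<open>H\<close>.

  The subgroup \<open>N\<close> is normal in \<open>H\<close> but, being larger than the core, not in \<open>G\<close>; by maximality
  \<open>H\<close> is its full normalizer (\<open>normalizing_in_maximal\<close>). Solvability supplies a normal subgroup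
  \<open>A\<close> of \<open>G\<close> with \<open>A H = G\<close> and \<open>A \<inter> H \<subseteq> K\<close>, namely the last term of the derived series that is not
  contained in \<open>H\<close> (\<open>solvable_maximal_supplement\<close>). Let \<open>g = a h\<close> normalize \<open>H\<^sub>1\<close>, with \<open>a \<in> A\<close> and
  \<open>h \<in> H\<close>. For \<open>n \<in> N\<close> the element \<open>h\<inverse> n h\<close> lies in \<open>N \<subseteq> K H\<^sub>1\<close>, so its conjugate under \<open>g\<close>, which is
  \<open>a n a\<inverse>\<close>, lies in \<open>K H\<^sub>1 \<subseteq> H\<close>. Therefore \<open>a n a\<inverse> n\<inverse> \<in> A \<inter> H \<subseteq> K \<subseteq> N\<close>, so \<open>a\<close> normalizes \<open>N\<close>, and
  \<open>a \<in> H\<close>, \<open>g \<in> H\<close> (\<open>normalizer_subset_maximal\<close>).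
\<close>

section \<open>Torsion in finite nilpotent groups\<close>

text \<open>The commutator \<open>x y x\<inverse> y\<inverse>\<close>, with the same convention as in \<^const>\<open>commutator_subgroup\<close>.\<close>
definition commutator :: "('a, 'b) monoid_scheme \<Rightarrow> 'a \<Rightarrow> 'a \<Rightarrow> 'a" where
  "commutator G x y = x \<otimes>\<^bsub>G\<^esub> y \<otimes>\<^bsub>G\<^esub> inv\<^bsub>G\<^esub> x \<otimes>\<^bsub>G\<^esub> inv\<^bsub>G\<^esub> y"

text \<open>
  The upper central series, described by elements instead of quotients: the next term consists of
  the \<open>x\<close> all of whose commutators \<open>x g x\<inverse> g\<inverse>\<close> lie in the present term, that is, of the elements
  that are central modulo it.
\<close>
primrec upper_central :: "('a, 'b) monoid_scheme \<Rightarrow> nat \<Rightarrow> 'a set" where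
  "upper_central G 0 = {\<one>\<^bsub>G\<^esub>}"
| "upper_central G (Suc n) =
     {x \<in> carrier G. \<forall>g \<in> carrier G. commutator G x g \<in> upper_central G n}"

context group
begin

lemma inv_cancel_left:
  "x \<in> carrier G \<Longrightarrow> y \<in> carrier G \<Longrightarrow> inv x \<otimes> (x \<otimes> y) = y"
  "x \<in> carrier G \<Longrightarrow> y \<in> carrier G \<Longrightarrow> x \<otimes> (inv x \<otimes> y) = y"
  by (simp_all add: m_assoc [symmetric])

lemma commutator_closed [simp]:
  "x \<in> carrier G \<Longrightarrow> y \<in> carrier G \<Longrightarrow> commutator G x y \<in> carrier G"
  by (simp add: commutator_def)

lemma commutator_eq_one:
  assumes x: "x \<in> carrier G" and y: "y \<in> carrier G" and "commutator G x y = \<one>"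
  shows "x \<otimes> y = y \<otimes> x"
proof -
  have "x \<otimes> y = commutator G x y \<otimes> (y \<otimes> x)"
    using x y by (simp add: commutator_def m_assoc inv_cancel_left)
  then show ?thesis using assms by simp
qed

lemma upper_central_normal: "upper_central G n \<lhd> G"
proof (induction n)
  case 0
  show ?case by (simp add: one_is_normal)
next
  case (Suc n)
  interpret Z: normal "upper_central G n" G by (rule Suc)
  show ?case
  proof (rule normal_invI)
    show "subgroup (upper_central G (Suc n)) G"
    proof (rule subgroupI)
      show "upper_central G (Suc n) \<subseteq> carrier G" by auto
      show "upper_central G (Suc n) \<noteq> {}"
        by (auto simp: commutator_def intro!: exI [of _ \<one>])
    next
      fix x assume x: "x \<in> upper_central G (Suc n)"
      have "commutator G (inv x) g \<in> upper_central G n" if g: "g \<in> carrier G" for g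
      proof -
        have "inv x \<otimes> inv (commutator G x g) \<otimes> inv (inv x) \<in> upper_central G n"
          using x g by (intro Z.inv_op_closed2) auto
        moreover have "inv x \<otimes> inv (commutator G x g) \<otimes> inv (inv x) = commutator G (inv x) g"
          using x g by (simp add: commutator_def m_assoc inv_mult_group inv_cancel_left)
        ultimately show ?thesis by simp
      qed
      then show "inv x \<in> upper_central G (Suc n)" using x by auto
    next
      fix x y assume x: "x \<in> upper_central G (Suc n)" and y: "y \<in> upper_central G (Suc n)"
      have "commutator G (x \<otimes> y) g \<in> upper_central G n" if g: "g \<in> carrier G" for g
      proof -
        have "x \<otimes> commutator G y g \<otimes> inv x \<otimes> commutator G x g \<in> upper_central G n"
          using x y g by (intro Z.m_closed Z.inv_op_closed2) auto
        moreover have "x \<otimes> commutator G y g \<otimes> inv x \<otimes> commutator G x g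
            = commutator G (x \<otimes> y) g"
          using x y g by (simp add: commutator_def m_assoc inv_mult_group inv_cancel_left)
        ultimately show ?thesis by simp
      qed
      then show "x \<otimes> y \<in> upper_central G (Suc n)" using x y by auto
    qed
  next
    fix h x assume h: "h \<in> carrier G" and x: "x \<in> upper_central G (Suc n)"
    have "commutator G (h \<otimes> x \<otimes> inv h) g \<in> upper_central G n" if g: "g \<in> carrier G" for g
    proof -
      have "h \<otimes> commutator G x (inv h \<otimes> g \<otimes> h) \<otimes> inv h \<in> upper_central G n"
        using h x g by (intro Z.inv_op_closed2) auto
      moreover have "h \<otimes> commutator G x (inv h \<otimes> g \<otimes> h) \<otimes> inv h
          = commutator G (h \<otimes> x \<otimes> inv h) g"
        using h x g by (simp add: commutator_def m_assoc inv_mult_group inv_cancel_left)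
      ultimately show ?thesis by simp
    qed
    then show "h \<otimes> x \<otimes> inv h \<in> upper_central G (Suc n)" using h x by auto
  qed
qed

text \<open>
  If the lower central series reaches \<open>1\<close> after \<open>n\<close> steps, then its term \<open>n - k\<close> is contained in
  the \<open>k\<close>-th term of the upper central series.
\<close>
lemma nilpotent_upper_central:
  assumes "nilpotent G"
  obtains n where "upper_central G n = carrier G"
proof -
  from assms obtain n where n: "lower_central G n = {\<one>}"
    by (auto simp: nilpotent_def)
  have carr: "lower_central G k \<subseteq> carrier G" for k
  proof (induction k)
    case (Suc k)
    then show ?case
      unfolding lower_central.simps commutator_subgroup_def
      by (intro generate_incl) auto
  qed simp
  have "lower_central G (n - k) \<subseteq> upper_central G k" if "k \<le> n" for k
    using that
  proof (induction k)
    case 0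
    then show ?case by (simp add: n)
  next
    case (Suc k)
    define i where "i = n - Suc k"
    have i: "n - k = Suc i" using Suc.prems by (simp add: i_def)
    show ?case
    proof
      fix x assume x: "x \<in> lower_central G (n - Suc k)"
      then have xi: "x \<in> lower_central G i" by (simp add: i_def)
      have "commutator G x g \<in> upper_central G k" if g: "g \<in> carrier G" for g
      proof -
        have "commutator G x g \<in> lower_central G (Suc i)"
          unfolding lower_central.simps commutator_subgroup_def commutator_def
          using xi g by (intro generate.incl) blast
        then show ?thesis using Suc i by auto
      qed
      then show "x \<in> upper_central G (Suc k)" using x carr by auto
    qed
  qed
  from this [of n] have "carrier G \<subseteq> upper_central G n" by simp
  then have "upper_central G n = carrier G"
    using normal_imp_subgroup [OF upper_central_normal] subgroup.subset by blast
  then show thesis by (rule that)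
qed

lemma commutator_pow_left:
  fixes k :: nat
  assumes x: "x \<in> carrier G" and g: "g \<in> carrier G"
    and comm: "x \<otimes> commutator G x g = commutator G x g \<otimes> x"
  shows "commutator G (x [^] k) g = commutator G x g [^] k"
proof (induction k)
  case 0
  show ?case using g by (simp add: commutator_def)
next
  case (Suc k)
  let ?c = "commutator G x g"
  have "x [^] k \<otimes> ?c = ?c \<otimes> x [^] k"
    using comm x g by (intro group_commutes_pow) auto
  then have conj: "x [^] k \<otimes> ?c \<otimes> inv (x [^] k) = ?c"
    using x g by (simp add: m_assoc)
  have "commutator G (x [^] Suc k) g
      = x [^] k \<otimes> ?c \<otimes> inv (x [^] k) \<otimes> commutator G (x [^] k) g"
    using x g by (simp add: commutator_def m_assoc inv_mult_group inv_cancel_left)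
  also have "\<dots> = ?c \<otimes> ?c [^] k" using conj Suc by simp
  also have "\<dots> = ?c [^] Suc k" using x g by (intro nat_pow_Suc2 [symmetric]) simp
  finally show ?case .
qed

text \<open>
  In \<open>G / M\<close> the elements \<open>x\<close> and \<open>[x, g]\<close> commute, so that \<open>[x, g]\<^sup>k = [x\<^sup>k, g]\<close> there.
\<close>
lemma commutator_pow_mod:
  fixes k :: nat
  assumes M: "M \<lhd> G" and x: "x \<in> carrier G" and g: "g \<in> carrier G"
    and comm: "commutator G (commutator G x g) x \<in> M"
    and pow: "commutator G (x [^] k) g \<in> M"
  shows "commutator G x g [^] k \<in> M"
proof -
  interpret M: normal M G by (rule M)
  interpret Q: group "G Mod M" by (rule M.factorgroup_is_group)
  interpret h: group_hom G "G Mod M" "\<lambda>a. M #> a"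
    by (simp add: group_hom.intro group_hom_axioms.intro M.r_coset_hom_Mod is_group
        M.factorgroup_is_group)
  have hc: "M #> commutator G a b = commutator (G Mod M) (M #> a) (M #> b)"
    if "a \<in> carrier G" "b \<in> carrier G" for a b
    using that by (simp add: commutator_def del: mult_FactGroup)
  have one: "M #> a = \<one>\<^bsub>G Mod M\<^esub> \<longleftrightarrow> a \<in> M" if "a \<in> carrier G" for a
    using that coset_join1 [of M a] M.rcos_const [OF is_group, of a] M.subgroup_axioms by auto
  let ?X = "M #> x" and ?Y = "M #> g"
  let ?C = "commutator (G Mod M) ?X ?Y"
  have X: "?X \<in> carrier (G Mod M)" and Y: "?Y \<in> carrier (G Mod M)"
    using x g h.hom_closed by auto
  have "commutator (G Mod M) ?C ?X = \<one>\<^bsub>G Mod M\<^esub>"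
    using comm x g by (simp add: hc [symmetric] one del: one_FactGroup)
  then have "?X \<otimes>\<^bsub>G Mod M\<^esub> ?C = ?C \<otimes>\<^bsub>G Mod M\<^esub> ?X"
    using Q.commutator_eq_one [OF Q.commutator_closed [OF X Y] X] by simp
  then have "commutator (G Mod M) (?X [^]\<^bsub>G Mod M\<^esub> k) ?Y = ?C [^]\<^bsub>G Mod M\<^esub> k"
    by (rule Q.commutator_pow_left [OF X Y])
  then have "M #> commutator G (x [^] k) g = M #> (commutator G x g [^] k)"
    using x g by (simp add: hc [symmetric] M.FactGroup_pow)
  then show ?thesis using pow x g one by (metis commutator_closed nat_pow_closed)
qed

lemma exists_element_of_prime_order:
  assumes "prime q" "finite (carrier G)" "q dvd order G"
  obtains x where "x \<in> carrier G" "x \<noteq> \<one>" "x [^] q = \<one>"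
proof -
  from assms(3) obtain m where "order G = q ^ 1 * m" by auto
  from sylow_thm [OF assms(1) is_group this assms(2)]
  obtain P where P: "subgroup P G" "card P = q" by auto
  have "P \<noteq> {\<one>}" using P assms(1) by auto
  then obtain x where x: "x \<in> P" "x \<noteq> \<one>" using subgroup.one_closed [OF P(1)] by blast
  interpret P: group "G\<lparr>carrier := P\<rparr>" by (rule subgroup_imp_group [OF P(1)])
  have "x [^]\<^bsub>G\<lparr>carrier := P\<rparr>\<^esub> order (G\<lparr>carrier := P\<rparr>) = \<one>\<^bsub>G\<lparr>carrier := P\<rparr>\<^esub>"
    using x by (intro P.pow_order_eq_1) auto
  then have "x [^] q = \<one>" using P by (simp add: order_def nat_pow_consistent [symmetric])
  then show thesis using that [of x] x subgroup.mem_carrier [OF P(1)] by simp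
qed

text \<open>
  If the centre has no element of order \<open>q\<close>, then no factor of the upper central series has
  one: for \<open>x\<close> in the term \<open>n + 2\<close> with \<open>x\<^sup>q\<close> in the term \<open>n + 1\<close>, the commutators \<open>[x, g]\<close> lie in
  the term \<open>n + 1\<close> and their \<open>q\<close>-th powers in the term \<open>n\<close>, so by induction they lie in the term
  \<open>n\<close>, and \<open>x\<close> is in the term \<open>n + 1\<close>. An element of order \<open>q\<close> would thus descend through the
  series to the trivial subgroup.
\<close>
lemma nilpotent_central_torsion:
  assumes "nilpotent G" "finite (carrier G)" "prime q" "q dvd order G"
  obtains z where "z \<in> carrier G" "\<forall>g \<in> carrier G. z \<otimes> g = g \<otimes> z" "z \<noteq> \<one>" "z [^] q = \<one>"
proof -
  have "\<exists>z \<in> carrier G. (\<forall>g \<in> carrier G. z \<otimes> g = g \<otimes> z) \<and> z \<noteq> \<one> \<and> z [^] q = \<one>"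
  proof (rule ccontr)
    assume contra: "\<not> ?thesis"
    have step: "x \<in> upper_central G n"
      if "x \<in> upper_central G (Suc n)" "x [^] q \<in> upper_central G n" for n x
      using that
    proof (induction n arbitrary: x)
      case 0
      then have x: "x \<in> carrier G" "x [^] q = \<one>" by auto
      have "x \<otimes> g = g \<otimes> x" if g: "g \<in> carrier G" for g
        using 0 x g by (intro commutator_eq_one) auto
      with x contra show ?case by auto
    next
      case (Suc n)
      have x: "x \<in> carrier G" using Suc.prems by auto
      have "commutator G x g \<in> upper_central G n" if g: "g \<in> carrier G" for g
      proof (rule Suc.IH)
        show c: "commutator G x g \<in> upper_central G (Suc n)" using Suc.prems(1) g by auto
        show "commutator G x g [^] q \<in> upper_central G n"
          using c Suc.prems(2) x g
          by (intro commutator_pow_mod [OF upper_central_normal x g]) auto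
      qed
      then show ?case using x by auto
    qed
    obtain x where x: "x \<in> carrier G" "x \<noteq> \<one>" "x [^] q = \<one>"
      using exists_element_of_prime_order [OF assms(3,2,4)] .
    obtain n where "upper_central G n = carrier G"
      using nilpotent_upper_central [OF assms(1)] .
    with x have "x \<in> upper_central G n" by simp
    then have "x \<in> upper_central G 0"
    proof (induction n)
      case (Suc n)
      have "x [^] q \<in> upper_central G n"
        using x subgroup.one_closed [OF normal_imp_subgroup [OF upper_central_normal]] by simp
      with Suc show ?case using step by blast
    qed
    with x show False by simp
  qed
  then show thesis using that by blast
qed

lemma order_prime_power_of_exponent:
  assumes "prime q" "finite (carrier G)" "\<And>x. x \<in> carrier G \<Longrightarrow> x [^] q = \<one>"
  obtains t where "order G = q ^ t"
proof -
  have "r = q" if r: "prime r" "r dvd order G" for r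
  proof -
    obtain x where x: "x \<in> carrier G" "x \<noteq> \<one>" "x [^] r = \<one>"
      using exists_element_of_prime_order [OF r(1) assms(2) r(2)] .
    have "ord x dvd r" "ord x dvd q"
      using x assms(3) pow_eq_id by auto
    moreover have "ord x \<noteq> 1" using x ord_eq_1 by auto
    ultimately show ?thesis using r(1) assms(1) by (metis prime_nat_iff)
  qed
  then have only_q: "\<not> (\<exists>r \<in> prime_factors (order G). r \<noteq> q)"
    by (auto dest: in_prime_factors_imp_prime in_prime_factors_imp_dvd)
  \<comment> \<open>An order without prime divisors other than \<open>q\<close> is a power of \<open>q\<close>.\<close>
  have "order G \<noteq> 0" using order_gt_0_iff_finite assms(2) by simp
  with only_q Ex_other_prime_factor [of "order G" q, OF _ _ assms(1)]
  obtain t where "normalize (order G) = q ^ t" by blast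
  then show thesis using that [of t] by simp
qed

section \<open>Products with normal subgroups\<close>

lemma subgroup_card_dvd:
  assumes "subgroup A G" "subgroup B G" "A \<subseteq> B"
  shows "card A dvd card B"
proof -
  interpret B: group "G\<lparr>carrier := B\<rparr>" by (rule subgroup_imp_group [OF assms(2)])
  have "card (rcosets\<^bsub>G\<lparr>carrier := B\<rparr>\<^esub> A) * card A = card B"
    using B.lagrange [OF subgroup_incl [OF assms]] by (simp add: order_def)
  then show ?thesis by (metis dvd_triv_right)
qed

lemma card_normal_mult:
  assumes N: "N \<lhd> G" and S: "subgroup S G"
  shows "card (N <#> S) * card (N \<inter> S) = card N * card S"
proof -
  interpret second_isomorphism_grp N G S
    by (intro second_isomorphism_grp.intro second_isomorphism_grp_axioms.intro N S)
  interpret S: group "G\<lparr>carrier := S\<rparr>" by (rule subgroup_imp_group [OF S])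
  interpret NS: group "G\<lparr>carrier := N <#> S\<rparr>"
    by (rule subgroup_imp_group [OF normal_set_mult_subgroup])
  have "card (carrier (G\<lparr>carrier := S\<rparr> Mod (N \<inter> S)))
      = card (carrier (G\<lparr>carrier := N <#> S\<rparr> Mod N))"
    using normal_intersection_quotient_isom by (intro iso_same_card) (auto simp: is_iso_def)
  then have index: "card (rcosets\<^bsub>G\<lparr>carrier := S\<rparr>\<^esub> (N \<inter> S))
      = card (rcosets\<^bsub>G\<lparr>carrier := N <#> S\<rparr>\<^esub> N)"
    by (simp add: FactGroup_def)
  have "card (rcosets\<^bsub>G\<lparr>carrier := S\<rparr>\<^esub> (N \<inter> S)) * card (N \<inter> S) = card S"
    using S.lagrange [of "N \<inter> S"] normal_imp_subgroup [OF normal_subgrp_intersection_normal]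
    by (simp add: order_def Int_commute)
  moreover have "card (rcosets\<^bsub>G\<lparr>carrier := N <#> S\<rparr>\<^esub> N) * card N = card (N <#> S)"
    using NS.lagrange [of N] subgroup_incl [OF normal_imp_subgroup [OF N]
        normal_set_mult_subgroup H_contained_in_set_mult]
    by (simp add: order_def)
  ultimately show ?thesis using index by (metis mult.assoc mult.commute)
qed

lemma normal_mult_normal:
  assumes M: "M \<lhd> G" and N: "N \<lhd> G"
  shows "M <#> N \<lhd> G"
proof (rule normal_invI)
  interpret M: normal M G by (rule M)
  interpret N: normal N G by (rule N)
  interpret MN: second_isomorphism_grp M G N
    by (intro second_isomorphism_grp.intro second_isomorphism_grp_axioms.intro M N.subgroup_axioms)
  show "subgroup (M <#> N) G" by (rule MN.normal_set_mult_subgroup)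
  fix x h assume x: "x \<in> carrier G" and h: "h \<in> M <#> N"
  then obtain m n where mn: "m \<in> M" "n \<in> N" "h = m \<otimes> n" by (auto simp: set_mult_def)
  have "x \<otimes> h \<otimes> inv x = (x \<otimes> m \<otimes> inv x) \<otimes> (x \<otimes> n \<otimes> inv x)"
    using x mn by (simp add: m_assoc inv_cancel_left)
  then show "x \<otimes> h \<otimes> inv x \<in> M <#> N"
    unfolding set_mult_def
    using M.inv_op_closed2 [OF x mn(1)] N.inv_op_closed2 [OF x mn(2)] by blast
qed

text \<open>
  The index \<open>j\<close> of \<open>K Q\<close> in \<open>N Q\<close> is a power of \<open>q\<close>, because \<open>N / K\<close> is a \<open>q\<close>-group, and it is
  prime to \<open>q\<close>, because \<open>K Q\<close> contains a Sylow \<open>q\<close>-subgroup. So \<open>N Q = K Q\<close>.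
\<close>
lemma subset_normal_mult_sylow:
  assumes fin: "finite (carrier G)" and Q: "sylow_subgroup q Q G"
    and K: "K \<lhd> G" and N: "N \<lhd> G" and KN: "K \<subseteq> N" and card: "card N = q ^ t * card K"
  shows "N \<subseteq> K <#> Q"
proof -
  have q: "prime q" and Qsub: "subgroup Q G" and cQ: "card Q = q ^ multiplicity q (order G)"
    using Q by (auto simp: sylow_subgroup_def)
  interpret KQ: second_isomorphism_grp K G Q
    by (intro second_isomorphism_grp.intro second_isomorphism_grp_axioms.intro K Qsub)
  interpret NQ: second_isomorphism_grp N G Q
    by (intro second_isomorphism_grp.intro second_isomorphism_grp_axioms.intro N Qsub)
  note sKQ = KQ.normal_set_mult_subgroup and sNQ = NQ.normal_set_mult_subgroup
  have pos: "card S > 0" if "subgroup S G" for S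
    using subgroup.finite_imp_card_positive [OF that fin] .
  have sub: "K <#> Q \<subseteq> N <#> Q" by (rule mono_set_mult [OF KN subset_refl])
  obtain j where j: "card (N <#> Q) = card (K <#> Q) * j"
    using subgroup_card_dvd [OF sKQ sNQ sub] by blast
  have sKcQ: "subgroup (K \<inter> Q) G"
    by (rule subgroups_Inter_pair [OF KQ.subgroup_axioms Qsub])
  have "card (K \<inter> Q) dvd card Q"
    by (rule subgroup_card_dvd [OF sKcQ Qsub]) auto
  then obtain s where s: "card (K \<inter> Q) = q ^ s"
    using cQ q by (auto simp: divides_primepow_nat)
  have "card (K <#> Q) * (j * card (N \<inter> Q)) = card (N <#> Q) * card (N \<inter> Q)"
    by (simp add: j)
  also have "\<dots> = q ^ t * (card K * card Q)"
    using card_normal_mult [OF N Qsub] card by simp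
  also have "\<dots> = card (K <#> Q) * (q ^ t * q ^ s)"
    using card_normal_mult [OF K Qsub] s by simp
  finally have "j * card (N \<inter> Q) = q ^ (t + s)"
    using pos [OF sKQ] by (simp add: power_add)
  then have "j dvd q ^ (t + s)" by (metis dvd_triv_left)
  then obtain i where i: "j = q ^ i" using q by (auto simp: divides_primepow_nat)
  have "card Q * q ^ i dvd card (K <#> Q) * q ^ i"
    using subgroup_card_dvd [OF Qsub sKQ KQ.S_contained_in_set_mult] by (rule mult_dvd_mono) simp
  also have "\<dots> dvd order G"
    using subgroup_card_dvd [OF sNQ subgroup_self subgroup.subset [OF sNQ]] j i
    by (simp add: order_def)
  finally have "q ^ (multiplicity q (order G) + i) dvd order G" by (simp add: cQ power_add)
  then have "i = 0"
    using q fin order_gt_0_iff_finite power_dvd_iff_le_multiplicity [of "order G" q]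
    by (metis add_le_same_cancel1 le_zero_eq less_numeral_extra(3) not_prime_unit)
  then have "K <#> Q = N <#> Q"
    using j i sub fin subgroup.subset [OF sNQ]
    by (intro card_subset_eq) (auto intro: finite_subset)
  then show ?thesis using NQ.H_contained_in_set_mult by simp
qed

lemma normal_preimage:
  assumes K: "K \<lhd> G" and T: "T \<lhd> (G Mod K)"
  obtains N where "N \<lhd> G" "K \<subseteq> N" "card N = card T * card K"
proof
  define N where "N = {x \<in> carrier G. K #> x \<in> T}"
  interpret K: normal K G by (rule K)
  interpret Q: group "G Mod K" by (rule K.factorgroup_is_group)
  interpret T: normal T "G Mod K" by (rule T)
  interpret h: group_hom G "G Mod K" "\<lambda>a. K #> a"
    by (simp add: group_hom.intro group_hom_axioms.intro K.r_coset_hom_Mod is_group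
        K.factorgroup_is_group)
  have hc: "K #> x \<in> carrier (G Mod K)" if "x \<in> carrier G" for x
    using that by (rule h.hom_closed)
  show normal: "N \<lhd> G"
  proof (rule normal_invI)
    show "subgroup N G"
    proof
      show "N \<subseteq> carrier G" by (auto simp: N_def)
      show "\<one> \<in> N" using h.hom_one T.one_closed by (simp add: N_def)
      show "x \<otimes> y \<in> N" if "x \<in> N" "y \<in> N" for x y
        using that T.m_closed h.hom_mult by (simp add: N_def)
      show "inv x \<in> N" if "x \<in> N" for x
        using that T.m_inv_closed h.hom_inv by (simp add: N_def)
    qed
    show "x \<otimes> y \<otimes> inv x \<in> N" if "x \<in> carrier G" "y \<in> N" for x y
      using that T.inv_op_closed2 [OF hc, of x "K #> y"] h.hom_mult h.hom_inv
      by (simp add: N_def)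
  qed
  show KN: "K \<subseteq> N"
    using K.rcos_const [OF is_group] T.one_closed by (auto simp: N_def K.mem_carrier)
  interpret N: group "G\<lparr>carrier := N\<rparr>"
    by (rule subgroup_imp_group [OF normal_imp_subgroup [OF normal]])
  have "rcosets\<^bsub>G\<lparr>carrier := N\<rparr>\<^esub> K = T"
    using T.subset by (auto simp: RCOSETS_def N_def carrier_FactGroup)
  then show "card N = card T * card K"
    using N.lagrange [OF subgroup_incl [OF K.subgroup_axioms normal_imp_subgroup [OF normal] KN]]
    by (simp add: order_def)
qed

section \<open>Primes dividing the order of the Fitting subgroup\<close>

text \<open>
  This needs neither that the Fitting subgroup is nilpotent nor a product decomposition of it: if
  \<open>q\<close> divided the order of no nilpotent normal subgroup, then a normal subgroup \<open>M\<close> maximal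
  among those of order prime to \<open>q\<close> would contain all of them, hence the subgroup generated by them.
\<close>
lemma fitting_prime_divisor:
  assumes fin: "finite (carrier G)" and q: "prime q" and dvd: "q dvd card (fitting_subgroup G)"
  obtains N where "N \<lhd> G" "nilpotent (G\<lparr>carrier := N\<rparr>)" "q dvd card N"
proof -
  have "\<exists>N. N \<lhd> G \<and> nilpotent (G\<lparr>carrier := N\<rparr>) \<and> q dvd card N"
  proof (rule ccontr)
    assume contra: "\<not> ?thesis"
    define \<A> where "\<A> = {M. M \<lhd> G \<and> \<not> q dvd card M}"
    have "\<A> \<subseteq> Pow (carrier G)"
      by (auto simp: \<A>_def dest: normal_imp_subgroup subgroup.subset)
    then have "finite \<A>" using fin by (meson finite_Pow_iff finite_subset)
    moreover have "{\<one>} \<in> \<A>" using one_is_normal q by (auto simp: \<A>_def)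
    ultimately obtain M where M: "M \<in> \<A>" and max: "\<And>B. B \<in> \<A> \<Longrightarrow> M \<subseteq> B \<Longrightarrow> M = B"
      by (metis empty_iff finite_has_maximal)
    have nM: "M \<lhd> G" using M by (simp add: \<A>_def)
    have "N \<subseteq> M" if N: "N \<lhd> G" "nilpotent (G\<lparr>carrier := N\<rparr>)" for N
    proof -
      interpret NM: second_isomorphism_grp N G M
        by (intro second_isomorphism_grp.intro second_isomorphism_grp_axioms.intro N
            normal_imp_subgroup nM)
      have "\<not> q dvd card N * card M" using contra N M q by (auto simp: \<A>_def prime_dvd_mult_iff)
      then have "\<not> q dvd card (N <#> M)"
        by (metis card_normal_mult [OF N(1) normal_imp_subgroup [OF nM]] dvd_mult2)
      then have "N <#> M \<in> \<A>" using normal_mult_normal [OF N(1) nM] by (simp add: \<A>_def)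
      then have "M = N <#> M" using max NM.S_contained_in_set_mult by blast
      then show ?thesis using NM.H_contained_in_set_mult by simp
    qed
    then have FM: "fitting_subgroup G \<subseteq> M"
      unfolding fitting_subgroup_def
      by (intro generate_subgroup_incl normal_imp_subgroup nM) auto
    have "subgroup (fitting_subgroup G) G"
      unfolding fitting_subgroup_def
      by (intro generate_is_subgroup) (auto dest: normal_imp_subgroup subgroup.mem_carrier)
    from subgroup_card_dvd [OF this normal_imp_subgroup [OF nM] FM] dvd M show False
      by (auto simp: \<A>_def dest: dvd_trans)
  qed
  then show thesis using that by blast
qed

lemma conj_pow:
  fixes k :: nat
  assumes "h \<in> carrier G" "x \<in> carrier G"
  shows "(h \<otimes> x \<otimes> inv h) [^] k = h \<otimes> x [^] k \<otimes> inv h"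
proof (induction k)
  case 0
  then show ?case using assms by simp
next
  case (Suc k)
  have "(h \<otimes> x \<otimes> inv h) [^] Suc k = (h \<otimes> x [^] k \<otimes> inv h) \<otimes> (h \<otimes> x \<otimes> inv h)"
    by (simp only: nat_pow_Suc Suc)
  also have "\<dots> = h \<otimes> (x [^] k \<otimes> x) \<otimes> inv h"
    using assms by (simp add: m_assoc inv_cancel_left)
  finally show ?case by (simp only: nat_pow_Suc)
qed

lemma normal_prime_power_of_nilpotent:
  assumes fin: "finite (carrier G)" and q: "prime q"
    and N: "N \<lhd> G" "nilpotent (G\<lparr>carrier := N\<rparr>)" "q dvd card N"
  obtains T t where "T \<lhd> G" "T \<noteq> {\<one>}" "card T = q ^ t"
proof -
  interpret N: normal N G by (rule N)
  interpret GN: group "G\<lparr>carrier := N\<rparr>" by (rule subgroup_imp_group [OF N.subgroup_axioms])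
  \<comment> \<open>\<open>T\<close> is characteristic in \<open>N\<close>, hence normal in \<open>G\<close>.\<close>
  define T where "T = {z \<in> N. z [^] q = \<one> \<and> (\<forall>g \<in> N. z \<otimes> g = g \<otimes> z)}"
  have TD: "z \<in> N" "z \<in> carrier G" "z [^] q = \<one>" if "z \<in> T" for z
    using that N.subset unfolding T_def by blast+
  have comm: "z \<otimes> g = g \<otimes> z" if "z \<in> T" "g \<in> N" for z g
    using that unfolding T_def by blast
  have TI: "z \<in> T" if "z \<in> N" "z [^] q = \<one>" "\<And>g. g \<in> N \<Longrightarrow> z \<otimes> g = g \<otimes> z" for z
    using that unfolding T_def by blast
  have TN: "T \<subseteq> carrier G" using TD(2) by blast
  have T: "T \<lhd> G"
  proof (rule normal_invI)
    show "subgroup T G"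
    proof (rule subgroupI [OF TN])
      have "\<one> \<in> T" by (rule TI) simp_all
      then show "T \<noteq> {}" by blast
    next
      fix z assume z: "z \<in> T"
      show "inv z \<in> T"
      proof (rule TI)
        show "inv z \<in> N" "inv z [^] q = \<one>" using TD [OF z] by (simp_all add: nat_pow_inv)
        fix g assume g: "g \<in> N"
        have "inv z \<otimes> (z \<otimes> g) \<otimes> inv z = inv z \<otimes> (g \<otimes> z) \<otimes> inv z"
          by (simp only: comm [OF z g])
        then show "inv z \<otimes> g = g \<otimes> inv z"
          using TD(2) [OF z] N.mem_carrier [OF g] by (simp add: m_assoc inv_cancel_left)
      qed
    next
      fix z y assume z: "z \<in> T" and y: "y \<in> T"
      note carr = TD(2) [OF z] TD(2) [OF y]
      show "z \<otimes> y \<in> T"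
      proof (rule TI)
        show "z \<otimes> y \<in> N" using TD z y by simp
        show "(z \<otimes> y) [^] q = \<one>"
          using pow_mult_distrib [OF comm [OF z TD(1) [OF y]] carr, of q] TD(3) z y by simp
        fix g assume g: "g \<in> N"
        have gc: "g \<in> carrier G" using g by (rule N.mem_carrier)
        have "z \<otimes> y \<otimes> g = z \<otimes> (g \<otimes> y)"
          using carr gc comm [OF y g] by (simp only: m_assoc)
        also have "\<dots> = g \<otimes> z \<otimes> y"
          using carr gc comm [OF z g] by (simp only: m_assoc [symmetric])
        also have "\<dots> = g \<otimes> (z \<otimes> y)" using carr gc by (simp only: m_assoc)
        finally show "z \<otimes> y \<otimes> g = g \<otimes> (z \<otimes> y)" .
      qed
    qed
  next
    fix h z assume h: "h \<in> carrier G" and z: "z \<in> T"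
    show "h \<otimes> z \<otimes> inv h \<in> T"
    proof (rule TI)
      show "h \<otimes> z \<otimes> inv h \<in> N" using h TD(1) [OF z] by (rule N.inv_op_closed2)
      show "(h \<otimes> z \<otimes> inv h) [^] q = \<one>" using h TD [OF z] by (simp add: conj_pow)
      fix g assume g: "g \<in> N"
      have "h \<otimes> (z \<otimes> (inv h \<otimes> g \<otimes> h)) \<otimes> inv h = h \<otimes> ((inv h \<otimes> g \<otimes> h) \<otimes> z) \<otimes> inv h"
        by (simp only: comm [OF z N.inv_op_closed1 [OF h g]])
      then show "(h \<otimes> z \<otimes> inv h) \<otimes> g = g \<otimes> (h \<otimes> z \<otimes> inv h)"
        using h TD(2) [OF z] N.mem_carrier [OF g] by (simp add: m_assoc inv_cancel_left)
    qed
  qed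
  obtain z where "z \<in> N" "\<forall>g \<in> N. z \<otimes> g = g \<otimes> z" "z \<noteq> \<one>" "z [^] q = \<one>"
    using GN.nilpotent_central_torsion [OF N(2) _ q] N(3) finite_subset [OF N.subset fin]
    by (auto simp: order_def nat_pow_consistent [symmetric])
  then have nontriv: "T \<noteq> {\<one>}" using TI by blast
  interpret GT: group "G\<lparr>carrier := T\<rparr>" by (rule subgroup_imp_group [OF normal_imp_subgroup [OF T]])
  obtain t where "order (G\<lparr>carrier := T\<rparr>) = q ^ t"
    using GT.order_prime_power_of_exponent [OF q] finite_subset [OF TN fin] TD(3)
    by (auto simp: nat_pow_consistent [symmetric])
  then show thesis using that [OF T nontriv] by (simp add: order_def)
qed

section \<open>Maximal subgroups and their cores\<close>

text \<open>
  The defining intersection runs over the conjugates \<open>g\<inverse> H g\<close>, so membership of \<open>x\<close> tests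
  \<open>g x g\<inverse> \<in> H\<close>.
\<close>
lemma normal_core_iff:
  assumes "subgroup H G"
  shows "x \<in> normal_core G H \<longleftrightarrow> x \<in> carrier G \<and> (\<forall>g \<in> carrier G. g \<otimes> x \<otimes> inv g \<in> H)"
proof -
  interpret H: subgroup H G by (rule assms)
  have conj: "x \<in> inv g <# H #> g \<longleftrightarrow> x \<in> carrier G \<and> g \<otimes> x \<otimes> inv g \<in> H"
    if g: "g \<in> carrier G" for g
  proof
    assume "x \<in> inv g <# H #> g"
    then obtain h where h: "h \<in> H" "x = inv g \<otimes> h \<otimes> g" by (auto simp: l_coset_def r_coset_def)
    then show "x \<in> carrier G \<and> g \<otimes> x \<otimes> inv g \<in> H" using g by (simp add: m_assoc inv_cancel_left)
  next
    assume x: "x \<in> carrier G \<and> g \<otimes> x \<otimes> inv g \<in> H"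
    then have "x = inv g \<otimes> (g \<otimes> x \<otimes> inv g) \<otimes> g" using g by (simp add: m_assoc inv_cancel_left)
    with x show "x \<in> inv g <# H #> g" by (force simp: l_coset_def r_coset_def)
  qed
  then show ?thesis using one_closed by (auto simp: normal_core_def)
qed

lemma normal_core_subset:
  assumes "subgroup H G"
  shows "normal_core G H \<subseteq> H"
proof
  fix x assume "x \<in> normal_core G H"
  then have "x \<in> carrier G" "\<one> \<otimes> x \<otimes> inv \<one> \<in> H"
    using one_closed unfolding normal_core_iff [OF assms] by blast+
  then show "x \<in> H" by simp
qed

lemma normal_core_greatest:
  assumes "subgroup H G" "N \<lhd> G" "N \<subseteq> H"
  shows "N \<subseteq> normal_core G H"
proof
  interpret N: normal N G by (rule assms(2))
  fix x assume "x \<in> N"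
  then show "x \<in> normal_core G H"
    using assms(3) N.inv_op_closed2 by (auto simp: normal_core_iff [OF assms(1)])
qed

lemma normal_core_normal:
  assumes "subgroup H G"
  shows "normal_core G H \<lhd> G"
proof (rule normal_invI)
  interpret H: subgroup H G by (rule assms)
  show "subgroup (normal_core G H) G"
  proof (rule subgroupI)
    show "normal_core G H \<subseteq> carrier G" by (auto simp: normal_core_iff [OF assms])
    have "\<one> \<in> normal_core G H" by (simp add: normal_core_iff [OF assms])
    then show "normal_core G H \<noteq> {}" by blast
  next
    fix x assume x: "x \<in> normal_core G H"
    have "g \<otimes> inv x \<otimes> inv g \<in> H" if g: "g \<in> carrier G" for g
    proof -
      have "inv (g \<otimes> x \<otimes> inv g) \<in> H" using x g by (simp add: normal_core_iff [OF assms])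
      then show ?thesis using x g by (simp add: normal_core_iff [OF assms] inv_mult_group m_assoc)
    qed
    then show "inv x \<in> normal_core G H" using x by (simp add: normal_core_iff [OF assms])
  next
    fix x y assume xy: "x \<in> normal_core G H" "y \<in> normal_core G H"
    have "g \<otimes> (x \<otimes> y) \<otimes> inv g \<in> H" if g: "g \<in> carrier G" for g
    proof -
      have "(g \<otimes> x \<otimes> inv g) \<otimes> (g \<otimes> y \<otimes> inv g) \<in> H"
        using xy g by (simp add: normal_core_iff [OF assms])
      then show ?thesis using xy g by (simp add: normal_core_iff [OF assms] m_assoc inv_cancel_left)
    qed
    then show "x \<otimes> y \<in> normal_core G H" using xy by (simp add: normal_core_iff [OF assms])
  qed
next
  fix h x assume h: "h \<in> carrier G" and x: "x \<in> normal_core G H"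
  have "g \<otimes> (h \<otimes> x \<otimes> inv h) \<otimes> inv g \<in> H" if g: "g \<in> carrier G" for g
  proof -
    have "(g \<otimes> h) \<otimes> x \<otimes> inv (g \<otimes> h) \<in> H" using x g h by (simp add: normal_core_iff [OF assms])
    then show ?thesis
      using x g h by (simp add: normal_core_iff [OF assms] inv_mult_group m_assoc)
  qed
  then show "h \<otimes> x \<otimes> inv h \<in> normal_core G H"
    using h x by (simp add: normal_core_iff [OF assms])
qed

lemma exp_derived_normal: "(derived G ^^ n) (carrier G) \<lhd> G"
  by (induction n) (auto intro: normal_self derived_is_normal)

text \<open>
  Let \<open>A\<close> be the last term of the derived series not contained in \<open>H\<close>. It supplements \<open>H\<close> by
  maximality. The derived subgroup of \<open>A\<close> lies in \<open>H\<close>, so \<open>A\<close> as well as \<open>H\<close> normalizes \<open>A \<inter> H\<close>,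
  which is therefore a normal subgroup of \<open>G\<close> inside \<open>H\<close>.
\<close>
lemma solvable_maximal_supplement:
  assumes "solvable G" and "maximal_subgroup H G"
  obtains A where "A \<lhd> G" "A <#> H = carrier G" "A \<inter> H \<subseteq> normal_core G H"
proof -
  have H: "subgroup H G" and proper: "H \<noteq> carrier G"
    and max: "\<And>K. subgroup K G \<Longrightarrow> H \<subseteq> K \<Longrightarrow> K = H \<or> K = carrier G"
    using assms(2) by (auto simp: maximal_subgroup_def)
  interpret H: subgroup H G by (rule H)
  obtain m where "(derived G ^^ m) (carrier G) = {\<one>}"
    using assms(1) solvable_iff_trivial_derived_seq by blast
  then have ex: "\<exists>m. (derived G ^^ m) (carrier G) \<subseteq> H" by (intro exI [of _ m]) simp
  define n where "n = (LEAST m. (derived G ^^ m) (carrier G) \<subseteq> H)"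
  have n: "(derived G ^^ n) (carrier G) \<subseteq> H"
    unfolding n_def by (rule LeastI_ex [OF ex])
  have "n \<noteq> 0"
    using n proper H.subset by (intro notI) auto
  then obtain k where k: "n = Suc k" by (cases n) auto
  define A where "A = (derived G ^^ k) (carrier G)"
  have "\<not> A \<subseteq> H"
    unfolding A_def using not_less_Least [of k] k n_def by (metis lessI)
  have derA: "derived G A \<subseteq> H" using n by (simp add: k A_def)
  have A: "A \<lhd> G" unfolding A_def by (rule exp_derived_normal)
  interpret AH: second_isomorphism_grp A G H
    by (intro second_isomorphism_grp.intro second_isomorphism_grp_axioms.intro A H)
  have AH: "A <#> H = carrier G"
    using max [OF AH.normal_set_mult_subgroup AH.S_contained_in_set_mult]
      AH.H_contained_in_set_mult \<open>\<not> A \<subseteq> H\<close> by auto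
  have AHsub: "subgroup (A \<inter> H) G" by (rule subgroups_Inter_pair [OF AH.subgroup_axioms H])
  have "A \<inter> H \<lhd> G"
  proof (rule normal_invI [OF AHsub])
    fix x y assume x: "x \<in> carrier G" and y: "y \<in> A \<inter> H"
    obtain a h where ah: "a \<in> A" "h \<in> H" "x = a \<otimes> h"
      using x unfolding AH [symmetric] set_mult_def by blast
    \<comment> \<open>Conjugate by \<open>h\<close> first; conjugation by \<open>a\<close> then changes \<open>z\<close> by the commutator of \<open>a\<close> and \<open>z\<close>.\<close>
    define z where "z = h \<otimes> y \<otimes> inv h"
    have z: "z \<in> A" "z \<in> H" using y ah AH.inv_op_closed2 by (auto simp: z_def)
    have "a \<otimes> z \<otimes> inv a \<otimes> inv z \<in> derived G A"
      unfolding derived_def using ah z by (intro generate.incl) blast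
    then have "a \<otimes> z \<otimes> inv a \<otimes> inv z \<otimes> z \<in> H" using derA z by blast
    then have "a \<otimes> z \<otimes> inv a \<in> H" using ah z by (simp add: m_assoc)
    moreover have "x \<otimes> y \<otimes> inv x = a \<otimes> z \<otimes> inv a"
      using ah y by (simp add: z_def m_assoc inv_mult_group)
    ultimately show "x \<otimes> y \<otimes> inv x \<in> A \<inter> H"
      using x y AH.inv_op_closed2 [of x y] by simp
  qed
  then have "A \<inter> H \<subseteq> normal_core G H" by (intro normal_core_greatest H) auto
  with A AH show thesis by (rule that)
qed

text \<open>
  The elements \<open>x\<close> with \<open>x N x\<inverse> \<subseteq> N\<close> form a subgroup because \<open>N\<close> is finite; it contains \<open>H\<close> and is
  not all of \<open>G\<close>.
\<close>
lemma normalizing_in_maximal: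
  assumes fin: "finite (carrier G)" and max: "maximal_subgroup H G"
    and N: "N \<lhd> G\<lparr>carrier := H\<rparr>" and "\<not> N \<lhd> G"
    and a: "a \<in> carrier G" and aN: "\<And>n. n \<in> N \<Longrightarrow> a \<otimes> n \<otimes> inv a \<in> N"
  shows "a \<in> H"
proof -
  have H: "subgroup H G" using max by (simp add: maximal_subgroup_def)
  interpret H: subgroup H G by (rule H)
  interpret GH: group "G\<lparr>carrier := H\<rparr>" by (rule subgroup_imp_group [OF H])
  have NsubH: "subgroup N G" using incl_subgroup [OF H normal_imp_subgroup [OF N]] .
  interpret N: subgroup N G by (rule NsubH)
  have NH: "h \<otimes> n \<otimes> inv h \<in> N" if "h \<in> H" "n \<in> N" for h n
    using GH.normal_invE(2) [OF N, of h n] that H by (simp add: m_inv_consistent)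
  define S where "S = {x \<in> carrier G. \<forall>n \<in> N. x \<otimes> n \<otimes> inv x \<in> N}"
  have "subgroup S G"
  proof (rule subgroupI)
    show "S \<subseteq> carrier G" by (auto simp: S_def)
    have "\<one> \<in> S" by (simp add: S_def)
    then show "S \<noteq> {}" by blast
  next
    fix x y assume xy: "x \<in> S" "y \<in> S"
    have "x \<otimes> y \<otimes> n \<otimes> inv (x \<otimes> y) \<in> N" if n: "n \<in> N" for n
    proof -
      have "x \<otimes> (y \<otimes> n \<otimes> inv y) \<otimes> inv x \<in> N" using xy n by (simp add: S_def)
      then show ?thesis using xy n by (simp add: S_def m_assoc inv_mult_group)
    qed
    then show "x \<otimes> y \<in> S" using xy by (simp add: S_def)
  next
    fix x assume x: "x \<in> S"
    have xc: "x \<in> carrier G" using x by (simp add: S_def)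
    have "(\<lambda>n. x \<otimes> n \<otimes> inv x) ` N = N"
    proof (rule endo_inj_surj)
      show "finite N" using N.subset fin by (rule finite_subset)
      show "(\<lambda>n. x \<otimes> n \<otimes> inv x) ` N \<subseteq> N" using x by (auto simp: S_def)
      show "inj_on (\<lambda>n. x \<otimes> n \<otimes> inv x) N"
        using xc by (intro inj_onI) simp
    qed
    have "inv x \<otimes> n \<otimes> inv (inv x) \<in> N" if n: "n \<in> N" for n
    proof -
      from n \<open>_ = N\<close> obtain m where m: "m \<in> N" "n = x \<otimes> m \<otimes> inv x" by blast
      then show ?thesis using xc by (simp add: m_assoc inv_cancel_left)
    qed
    then show "inv x \<in> S" using xc by (simp add: S_def)
  qed
  moreover have "H \<subseteq> S" using NH by (auto simp: S_def)
  ultimately have "S = H \<or> S = carrier G" using max by (auto simp: maximal_subgroup_def)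
  moreover have "S \<noteq> carrier G"
  proof
    assume "S = carrier G"
    then have "N \<lhd> G" by (intro normal_invI NsubH) (auto simp: S_def)
    with assms(4) show False ..
  qed
  moreover have "a \<in> S" using a aN by (simp add: S_def)
  ultimately show ?thesis by simp
qed

text \<open>
  The hypothesis on \<open>H\<^sub>1\<close> is only that it covers \<open>N\<close> modulo the core; \<open>H\<^sub>1\<close> need not contain the
  core, nor be a subgroup.
\<close>
lemma normalizer_subset_maximal:
  assumes fin: "finite (carrier G)" and sol: "solvable G" and max: "maximal_subgroup H G"
    and N: "N \<lhd> G\<lparr>carrier := H\<rparr>" and core: "normal_core G H \<subset> N"
    and H1: "H1 \<subseteq> H" and NH1: "N \<subseteq> normal_core G H <#> H1"
  shows "normalizer G H1 \<subseteq> H"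
proof
  fix g assume g: "g \<in> normalizer G H1"
  let ?K = "normal_core G H"
  have H: "subgroup H G" using max by (simp add: maximal_subgroup_def)
  interpret H: subgroup H G by (rule H)
  interpret GH: group "G\<lparr>carrier := H\<rparr>" by (rule subgroup_imp_group [OF H])
  interpret N: subgroup N G by (rule incl_subgroup [OF H normal_imp_subgroup [OF N]])
  have NsubH: "N \<subseteq> H" using subgroup.subset [OF normal_imp_subgroup [OF N]] by simp
  have NH: "h \<otimes> n \<otimes> inv h \<in> N" if "h \<in> H" "n \<in> N" for h n
    using GH.normal_invE(2) [OF N, of h n] that H by (simp add: m_inv_consistent)
  interpret K: normal ?K G by (rule normal_core_normal [OF H])
  have H1c: "H1 \<subseteq> carrier G" using H1 H.subset by blast
  have gc: "g \<in> carrier G" and gH1: "g <# H1 #> inv g = H1"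
    using g H1c by (auto simp: normalizer_def stabilizer_def)
  obtain A where A: "A \<lhd> G" "A <#> H = carrier G" "A \<inter> H \<subseteq> ?K"
    using solvable_maximal_supplement [OF sol max] .
  interpret A: normal A G by (rule A)
  obtain a h where ah: "a \<in> A" "h \<in> H" "g = a \<otimes> h"
    using gc unfolding A(2) [symmetric] set_mult_def by blast
  have "a \<otimes> n \<otimes> inv a \<in> N" if n: "n \<in> N" for n
  proof -
    define m where "m = inv h \<otimes> n \<otimes> h"
    have "m \<in> N" using NH [of "inv h" n] ah n by (simp add: m_def)
    then obtain k y where ky: "k \<in> ?K" "y \<in> H1" "m = k \<otimes> y"
      using NH1 by (auto simp: set_mult_def)
    have yc: "y \<in> carrier G" using ky H1c by blast
    have "g \<otimes> y \<otimes> inv g \<in> g <# H1 #> inv g" using ky by (auto simp: l_coset_def r_coset_def)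
    then have "g \<otimes> y \<otimes> inv g \<in> H" using gH1 H1 by blast
    moreover have "g \<otimes> k \<otimes> inv g \<in> H"
      using K.inv_op_closed2 [OF gc ky(1)] normal_core_subset [OF H] by blast
    ultimately have "(g \<otimes> k \<otimes> inv g) \<otimes> (g \<otimes> y \<otimes> inv g) \<in> H" by blast
    also have "(g \<otimes> k \<otimes> inv g) \<otimes> (g \<otimes> y \<otimes> inv g) = g \<otimes> m \<otimes> inv g"
      using gc ky yc by (simp add: m_assoc inv_cancel_left)
    also have "\<dots> = a \<otimes> n \<otimes> inv a"
      using ah n by (simp add: m_def m_assoc inv_cancel_left inv_mult_group)
    finally have conjH: "a \<otimes> n \<otimes> inv a \<in> H" .
    have "a \<otimes> (n \<otimes> inv a \<otimes> inv n) \<in> A"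
      using ah n A.inv_op_closed2 by simp
    then have "a \<otimes> n \<otimes> inv a \<otimes> inv n \<in> A" using ah n by (simp add: m_assoc)
    moreover have "a \<otimes> n \<otimes> inv a \<otimes> inv n \<in> H" using conjH n NsubH by blast
    ultimately have "a \<otimes> n \<otimes> inv a \<otimes> inv n \<in> N" using A(3) core by blast
    then have "a \<otimes> n \<otimes> inv a \<otimes> inv n \<otimes> n \<in> N" using n by simp
    then show ?thesis using ah n by (simp add: m_assoc)
  qed
  moreover have "\<not> N \<lhd> G" using normal_core_greatest [OF H _ NsubH] core by blast
  ultimately have "a \<in> H"
    using ah by (intro normalizing_in_maximal [OF fin max N]) auto
  then show "g \<in> H" using ah by simp
qed

end

theorem corollary1p1:
  fixes G :: "('a, 'b) monoid_scheme" (structure)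
    and H :: "'a set" and q :: nat
  assumes "group G" and "finite (carrier G)" and "solvable G"
    and "maximal_subgroup H G" and "\<not> H \<lhd> G"
    and "q \<in> prime_factors (card (fitting_subgroup ((G\<lparr>carrier := H\<rparr>) Mod (normal_core G H))))"
  shows "\<exists>Q. sylow_subgroup q Q (G\<lparr>carrier := H\<rparr>) \<and>
           (\<forall>H1. subgroup H1 (G\<lparr>carrier := H\<rparr>) \<longrightarrow> Q \<subseteq> H1 \<longrightarrow> H1 \<subseteq> H \<longrightarrow> normalizer G H1 \<subseteq> H)"
proof -
  interpret group G by (rule assms(1))
  let ?H = "G\<lparr>carrier := H\<rparr>" and ?K = "normal_core G H"
  have H: "subgroup H G" using assms(4) by (simp add: maximal_subgroup_def)
  interpret H: group ?H by (rule subgroup_imp_group [OF H])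
  have finH: "finite (carrier ?H)" using finite_subset [OF subgroup.subset [OF H] assms(2)] by simp
  have q: "prime q" "q dvd card (fitting_subgroup (?H Mod ?K))"
    using assms(6) by (auto simp: in_prime_factors_iff)
  have K: "?K \<lhd> ?H"
    by (rule normal_restrict_supergroup [OF H normal_core_normal [OF H] normal_core_subset [OF H]])
  interpret X: group "?H Mod ?K" by (rule normal.factorgroup_is_group [OF K])
  have finX: "finite (carrier (?H Mod ?K))" using finH by (simp add: carrier_FactGroup)
  obtain L where "L \<lhd> ?H Mod ?K" "nilpotent ((?H Mod ?K)\<lparr>carrier := L\<rparr>)" "q dvd card L"
    using X.fitting_prime_divisor [OF finX q] .
  then obtain T t where T: "T \<lhd> ?H Mod ?K" "T \<noteq> {\<one>\<^bsub>?H Mod ?K\<^esub>}" "card T = q ^ t"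
    using X.normal_prime_power_of_nilpotent [OF finX q(1)] by metis
  obtain N where N: "N \<lhd> ?H" "?K \<subseteq> N" "card N = card T * card ?K"
    using H.normal_preimage [OF K T(1)] .
  have "card T \<noteq> 1"
    using T(2) subgroup.one_closed [OF normal_imp_subgroup [OF T(1)]] by (auto simp: card_1_singleton_iff)
  moreover have "card ?K > 0"
    using subgroup.finite_imp_card_positive [OF normal_imp_subgroup [OF K] finH] .
  ultimately have core: "?K \<subset> N" using N by auto
  obtain m where "order ?H = q ^ multiplicity q (order ?H) * m"
    using multiplicity_dvd by (metis dvdE)
  from sylow_thm [OF q(1) H.is_group this finH]
  obtain Q where Q: "sylow_subgroup q Q ?H" using q(1) by (auto simp: sylow_subgroup_def)
  have NQ: "N \<subseteq> ?K <#> Q"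
    using H.subset_normal_mult_sylow [OF finH Q K N(1,2), of t] N(3) T(3)
    by (metis set_mult_consistent)
  have "normalizer G H1 \<subseteq> H" if "Q \<subseteq> H1" "H1 \<subseteq> H" for H1
    using NQ mono_set_mult [OF subset_refl [of ?K] that(1), of G] that
    by (intro normalizer_subset_maximal [OF assms(2-4) N(1) core]) auto
  with Q show ?thesis by blast
qed

end
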